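(* For every integer $n\ge 3$, $$\gamma_{rdR}(C_n\odot K_1)=\begin{cases}\left\lceil\frac{7n}{3}\right\rceil, & n\equiv 0,1\pmod 3,\\[2pt] \left\lceil\frac{7n}{3}\right\rceil+1, & n\equiv 2\pmod 3.\end{cases}$$
   Context: Graphs are finite and simple. A restrained double Roman dominating function (RDRD-function) of a graph $G$ is a function $f:V(G)\to\{0,1,2,3\}$ such that: (i) if $f(v)=0$, then $v$ has at least two neighbours assigned 2 under $f$ or at least one neighbour assigned 3; (ii) if $f(v)=1$, then $v$ has a neighbour $u$ with $f(u)\ge 2$; (iii) the subgraph of $G$ induced by the vertices assigned 0 contains no isolated vertex. The weight of $f$ is $\sum_{v\in V(G)}f(v)$, and $\gamma_{rdR}(G)$ is the minimum weight of an RDRD-function of $G$. $C_n$ is the cycle on $n$ vertices. The corona $G\odot K_1$ is the graph obtained from $G$ by adding, for each vertex $v\in V(G)$, a new leaf $v'$ adjacent only to $v$. *)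

theory Defs
  imports Complex_Main "HOL-Library.FuncSet" "Graph_Theory.Graph_Theory"
begin

text \<open>
  Finite simple graphs are the \<^locale>\<open>pair_graph\<close>s: finite loop-free digraphs without parallel
  arcs whose arc relation is symmetric, an edge \<open>uv\<close> being the two arcs \<open>(u, v)\<close> and \<open>(v, u)\<close>.
\<close>

definition neighbours :: "'a pair_pre_digraph \<Rightarrow> 'a \<Rightarrow> 'a set" where
  "neighbours G v = {u \<in> pverts G. (v, u) \<in> parcs G}"

definition isolated_vertex :: "('a, 'b) pre_digraph \<Rightarrow> 'a \<Rightarrow> bool" where
  "isolated_vertex H v \<longleftrightarrow> v \<in> verts H \<and> out_arcs H v = {} \<and> in_arcs H v = {}"

definition RDRD_function :: "'a pair_pre_digraph \<Rightarrow> ('a \<Rightarrow> nat) \<Rightarrow> bool" where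
  "RDRD_function G f \<longleftrightarrow>
     f \<in> pverts G \<rightarrow>\<^sub>E {0, 1, 2, 3} \<and>
     (\<forall>v\<in>pverts G. f v = 0 \<longrightarrow>
        card {u \<in> neighbours G v. f u = 2} \<ge> 2 \<or> card {u \<in> neighbours G v. f u = 3} \<ge> 1) \<and>
     (\<forall>v\<in>pverts G. f v = 1 \<longrightarrow> (\<exists>u\<in>neighbours G v. f u \<ge> 2)) \<and>
     \<not> (\<exists>v. isolated_vertex (with_proj G \<restriction> {u \<in> pverts G. f u = 0}) v)"

definition weight :: "'a pair_pre_digraph \<Rightarrow> ('a \<Rightarrow> nat) \<Rightarrow> nat" where
  "weight G f = (\<Sum>v\<in>pverts G. f v)"

text \<open>
  The minimum exists for every graph: the constant function 2 is an RDRD-function.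
\<close>

definition rdR_number :: "'a pair_pre_digraph \<Rightarrow> nat" (\<open>\<gamma>\<^sub>r\<^sub>d\<^sub>R\<close>) where
  "\<gamma>\<^sub>r\<^sub>d\<^sub>R G = (LEAST w. \<exists>f. RDRD_function G f \<and> weight G f = w)"

lemma RDRD_function_const_2: "RDRD_function G (\<lambda>v\<in>pverts G. 2)"
  by (auto simp: RDRD_function_def isolated_vertex_def)

lemma rdR_number_attained: "\<exists>f. RDRD_function G f \<and> weight G f = \<gamma>\<^sub>r\<^sub>d\<^sub>R G"
  unfolding rdR_number_def by (rule LeastI_ex) (use RDRD_function_const_2 in blast)

lemma rdR_number_le: "RDRD_function G f \<Longrightarrow> \<gamma>\<^sub>r\<^sub>d\<^sub>R G \<le> weight G f"
  unfolding rdR_number_def by (rule Least_le) blast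

definition cycle_graph :: "nat \<Rightarrow> nat pair_pre_digraph" where
  "cycle_graph n = \<lparr>
     pverts = {0..<n},
     parcs = {(i, j). i < n \<and> j < n \<and> (j = (i + 1) mod n \<or> i = (j + 1) mod n)} \<rparr>"

lemma pair_graph_cycle_graph:
  assumes "n \<ge> 3"
  shows "pair_graph (cycle_graph n)"
proof
  have "parcs (cycle_graph n) \<subseteq> {0..<n} \<times> {0..<n}"
    by (auto simp: cycle_graph_def)
  then show "finite (parcs (cycle_graph n))"
    by (rule finite_subset) simp
  show "symmetric (with_proj (cycle_graph n))"
    by (auto simp: symmetric_def cycle_graph_def sym_def)
  show "fst e \<noteq> snd e" if "e \<in> parcs (cycle_graph n)" for e
    using that assms by (auto simp: cycle_graph_def mod_Suc split: if_splits)
qed (auto simp: cycle_graph_def)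

text \<open>\<open>Inl v\<close> is the vertex \<open>v\<close> of \<open>G\<close> and \<open>Inr v\<close> the leaf \<open>v'\<close> attached to it.\<close>

definition corona_K1 :: "'a pair_pre_digraph \<Rightarrow> ('a + 'a) pair_pre_digraph" where
  "corona_K1 G = \<lparr>
     pverts = Inl ` pverts G \<union> Inr ` pverts G,
     parcs = {(Inl u, Inl v) | u v. (u, v) \<in> parcs G}
       \<union> {(Inl v, Inr v) | v. v \<in> pverts G}
       \<union> {(Inr v, Inl v) | v. v \<in> pverts G} \<rparr>"

lemma pair_graph_corona_K1:
  assumes "pair_graph G"
  shows "pair_graph (corona_K1 G)"
proof -
  interpret pair_graph G by fact
  show ?thesis
  proof
    have "parcs (corona_K1 G) \<subseteq> pverts (corona_K1 G) \<times> pverts (corona_K1 G)"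
      by (auto simp: corona_K1_def dest: in_arcsD1 in_arcsD2)
    then show "finite (parcs (corona_K1 G))"
      by (rule finite_subset) (simp add: corona_K1_def)
    show "symmetric (with_proj (corona_K1 G))"
      using pair_sym_arcs by (auto simp: symmetric_def corona_K1_def sym_def)
    show "fst e \<noteq> snd e" if "e \<in> parcs (corona_K1 G)" for e
      using that pair_no_loops by (auto simp: corona_K1_def)
  qed (auto simp: corona_K1_def dest: in_arcsD1 in_arcsD2)
qed

end

theory Submission
  imports Defs
begin

text \<open>
  Group the vertices of \<open>C\<^sub>n \<odot> K\<^sub>1\<close> into \<open>n\<close> columns, each a cycle vertex with its leaf. A leaf cannot
  have value 0: its only neighbour would have to have value 0 (no isolated zeros) and value 3
  (domination). A leaf of value 1 needs its cycle vertex to have value at least 2. Hence each column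
  weighs at least 2, and a column of weight 2 is a cycle vertex of value 0 below a leaf of value 2;
  such a light column needs a 0 on one of its two neighbours in the cycle and a value of at least 2
  on the other.

  Three consecutive light columns are therefore impossible, so every window of three consecutive
  columns weighs at least 7 and three times the weight, being the sum over all \<open>n\<close> windows, is at
  least \<open>7n\<close>. Divisibility by 3 turns this into the claimed value unless \<open>n \<equiv> 2 (mod 3)\<close>, where a
  triple weight of \<open>7n + 1\<close> still has to be excluded. There exactly one window would weigh 8 and all
  the others 7. Comparing neighbouring windows forces the column weights \<open>2, 2, 3, 2, 3, 2, 2\<close> around the
  exceptional one (lemma \<open>exceptional_window_impossible\<close>). The light column in the centre has a 0 on
  one side, and the next light column beyond that 0 then has zeros on both sides of its cycle
  vertex, which is impossible.

  For the upper bound, write a column as (cycle vertex, leaf), repeat (0,2), (0,2), (2,1) and fill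
  the remaining \<open>n mod 3\<close> places with (2,1). The weight \<open>7\<lfloor>n/3\<rfloor> + 3 (n mod 3)\<close> agrees with the lower
  bound for each residue.
\<close>

section \<open>Restrained domination in a corona of a cycle\<close>

lemma isolated_vertex_induce_iff:
  assumes "pair_graph G" "S \<subseteq> pverts G"
  shows "isolated_vertex (with_proj G \<restriction> S) v \<longleftrightarrow> v \<in> S \<and> neighbours G v \<inter> S = {}"
proof -
  interpret pair_graph G by fact
  show ?thesis
    using assms(2) arcs_symmetric
    by (auto simp: isolated_vertex_def neighbours_def out_arcs_def in_arcs_def)
qed

lemma RDRD_function_iff:
  assumes "pair_graph G"
  shows "RDRD_function G f \<longleftrightarrow>
     f \<in> pverts G \<rightarrow>\<^sub>E {0, 1, 2, 3} \<and>
     (\<forall>v\<in>pverts G. f v = 0 \<longrightarrow>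
        card {u \<in> neighbours G v. f u = 2} \<ge> 2 \<or> card {u \<in> neighbours G v. f u = 3} \<ge> 1) \<and>
     (\<forall>v\<in>pverts G. f v = 1 \<longrightarrow> (\<exists>u\<in>neighbours G v. f u \<ge> 2)) \<and>
     (\<forall>v\<in>pverts G. f v = 0 \<longrightarrow> (\<exists>u\<in>neighbours G v. f u = 0))"
proof -
  have "\<not> (\<exists>v. isolated_vertex (with_proj G \<restriction> {u \<in> pverts G. f u = 0}) v) \<longleftrightarrow>
      (\<forall>v\<in>pverts G. f v = 0 \<longrightarrow> (\<exists>u\<in>neighbours G v. f u = 0))"
    by (subst isolated_vertex_induce_iff[OF assms]) (auto simp: neighbours_def disjoint_iff)
  then show ?thesis
    unfolding RDRD_function_def by (simp only:)
qed

lemma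
  assumes "pair_graph G" "RDRD_function G f" "v \<in> pverts G"
  shows RDRD_zero_dominated: "f v = 0 \<Longrightarrow>
      card {u \<in> neighbours G v. f u = 2} \<ge> 2 \<or> card {u \<in> neighbours G v. f u = 3} \<ge> 1"
    and RDRD_one_dominated: "f v = 1 \<Longrightarrow> \<exists>u\<in>neighbours G v. f u \<ge> 2"
    and RDRD_zero_next_to_zero: "f v = 0 \<Longrightarrow> \<exists>u\<in>neighbours G v. f u = 0"
proof -
  note conds = assms(2)[unfolded RDRD_function_iff[OF assms(1)], THEN conjunct2]
  show "f v = 0 \<Longrightarrow>
      card {u \<in> neighbours G v. f u = 2} \<ge> 2 \<or> card {u \<in> neighbours G v. f u = 3} \<ge> 1"
    by (rule conds[THEN conjunct1, THEN bspec, OF assms(3), THEN mp])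
  show "f v = 1 \<Longrightarrow> \<exists>u\<in>neighbours G v. f u \<ge> 2"
    by (rule conds[THEN conjunct2, THEN conjunct1, THEN bspec, OF assms(3), THEN mp])
  show "f v = 0 \<Longrightarrow> \<exists>u\<in>neighbours G v. f u = 0"
    by (rule conds[THEN conjunct2, THEN conjunct2, THEN bspec, OF assms(3), THEN mp])
qed

lemma neighbours_corona_leaf:
  "v \<in> pverts G \<Longrightarrow> neighbours (corona_K1 G) (Inr v) = {Inl v}"
  by (auto simp: neighbours_def corona_K1_def)

lemma neighbours_corona_base:
  "v \<in> pverts G \<Longrightarrow> neighbours (corona_K1 G) (Inl v) = insert (Inr v) (Inl ` neighbours G v)"
  by (auto simp: neighbours_def corona_K1_def)

text \<open>
  Writing the centre as a successor avoids predecessors modulo \<open>n\<close>; every vertex of the cycle has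
  this form.
\<close>

lemma neighbours_cycle_graph:
  assumes "n > 0"
  shows "neighbours (cycle_graph n) ((i + 1) mod n) = {i mod n, (i + 2) mod n}"
proof -
  have pred: "(i + 1) mod n = (j + 1) mod n \<longleftrightarrow> j = i mod n" if "j < n" for j
    using that assms by (auto simp: mod_Suc split: if_splits)
  have succ: "((i + 1) mod n + 1) mod n = (i + 2) mod n"
    by (simp add: mod_simps)
  have "j < n \<and> (j = ((i + 1) mod n + 1) mod n \<or> (i + 1) mod n = (j + 1) mod n) \<longleftrightarrow>
      j \<in> {i mod n, (i + 2) mod n}" for j
  proof (cases "j < n")
    case True
    show ?thesis
      unfolding pred[OF True] succ using True by blast
  next
    case False
    then have "j \<noteq> x mod n" for x
      using mod_less_divisor[OF assms] by blast
    with False show ?thesis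
      by blast
  qed
  moreover have "neighbours (cycle_graph n) ((i + 1) mod n) =
      {j. j < n \<and> (j = ((i + 1) mod n + 1) mod n \<or> (i + 1) mod n = (j + 1) mod n)}"
    using assms by (auto simp: neighbours_def cycle_graph_def)
  ultimately show ?thesis
    by blast
qed

lemma weight_corona_K1:
  assumes "finite (pverts G)"
  shows "weight (corona_K1 G) f = (\<Sum>v\<in>pverts G. f (Inl v) + f (Inr v))"
proof -
  have "weight (corona_K1 G) f = sum f (Inl ` pverts G) + sum f (Inr ` pverts G)"
    unfolding weight_def corona_K1_def using assms by (simp, subst sum.union_disjoint) auto
  then show ?thesis
    by (simp add: sum.reindex sum.distrib)
qed

section \<open>Window sums of column weights\<close>

lemma sum_periodic_shift:
  fixes g :: "nat \<Rightarrow> nat"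
  assumes "\<And>i. g (i + n) = g i"
  shows "(\<Sum>i<n. g (i + 1)) = (\<Sum>i<n. g i)"
proof -
  have "g 0 + (\<Sum>i<n. g (Suc i)) = (\<Sum>i<n. g i) + g n"
    by (metis sum.lessThan_Suc sum.lessThan_Suc_shift)
  with assms[of 0] show ?thesis by simp
qed

text \<open>
  What the lower bound uses of an RDRD-function: \<open>a i\<close> is the value on the cycle vertex of column
  \<open>i\<close>, \<open>w i\<close> the weight of that column, both continued with period \<open>n\<close> to all natural numbers.
\<close>

locale column_profile =
  fixes n :: nat and a w :: "nat \<Rightarrow> nat"
  assumes n_ge_3: "n \<ge> 3"
    and periodic: "w (i + n) = w i"
    and w_ge_2: "w i \<ge> 2"
    and light_zero: "w i = 2 \<Longrightarrow> a i = 0"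
    and light_next_to_zero: "w (i + 1) = 2 \<Longrightarrow> a i = 0 \<or> a (i + 2) = 0"
    and light_dominated: "w (i + 1) = 2 \<Longrightarrow> a i \<ge> 2 \<or> a (i + 2) \<ge> 2"
begin

definition window :: "nat \<Rightarrow> nat" where
  "window i = w i + w (i + 1) + w (i + 2)"

lemma window_periodic: "window (i + n) = window i"
  using periodic[of i] periodic[of "i + 1"] periodic[of "i + 2"]
  by (simp add: window_def add_ac)

lemma window_mod: "window (i mod n) = window i"
proof -
  have "window (i + k * n) = window i" for i k
  proof (induction k)
    case (Suc k)
    then show ?case
      using window_periodic[of "i + k * n"] by (simp add: add_ac)
  qed simp
  from this[of "i mod n" "i div n"] show ?thesis
    by simp
qed

lemma not_three_light: "\<not> (w i = 2 \<and> w (i + 1) = 2 \<and> w (i + 2) = 2)"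
  using light_zero[of i] light_zero[of "i + 2"] light_dominated[of i] by auto

lemma window_ge_7: "window i \<ge> 7"
  using not_three_light[of i] w_ge_2[of i] w_ge_2[of "i + 1"] w_ge_2[of "i + 2"]
  unfolding window_def by linarith

lemma sum_window: "(\<Sum>i<n. window i) = 3 * (\<Sum>i<n. w i)"
proof -
  have 1: "(\<Sum>i<n. w (i + 1)) = (\<Sum>i<n. w i)"
    using sum_periodic_shift[of w] periodic by blast
  have "(\<Sum>i<n. w (i + 1 + 1)) = (\<Sum>i<n. w (i + 1))"
    using periodic[of "_ + 1"] by (intro sum_periodic_shift) (simp add: add_ac)
  with 1 show ?thesis
    by (simp add: window_def sum.distrib)
qed

lemma sum_ge: "7 * n \<le> 3 * (\<Sum>i<n. w i)"
proof -
  have "(\<Sum>i<n. 7) \<le> (\<Sum>i<n. window i)"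
    using window_ge_7 by (intro sum_mono)
  then show ?thesis by (simp add: sum_window)
qed

text \<open>
  Windows one apart differ by the difference of their end columns, so the exceptional window has
  columns 3, 2, 3 and the two columns on either side of it are light. The pairs of light columns
  force nonzero values on both cycle vertices next to the central light column.
\<close>

lemma exceptional_window_impossible:
  assumes "window (j + 2) = 8"
    and "window j = 7" "window (j + 1) = 7" "window (j + 3) = 7" "window (j + 4) = 7"
  shows False
proof -
  have W: "w (j + 2) + w (j + 3) + w (j + 4) = 8" "w j + w (j + 1) + w (j + 2) = 7"
    "w (j + 1) + w (j + 2) + w (j + 3) = 7" "w (j + 3) + w (j + 4) + w (j + 5) = 7"
    "w (j + 4) + w (j + 5) + w (j + 6) = 7"
    using assms by (simp_all add: window_def eval_nat_numeral)
  note ge = w_ge_2[of j] w_ge_2[of "j + 1"] w_ge_2[of "j + 2"] w_ge_2[of "j + 3"]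
    w_ge_2[of "j + 4"] w_ge_2[of "j + 5"] w_ge_2[of "j + 6"]
  have light: "w j = 2" "w (j + 1) = 2" "w (j + 3) = 2" "w (j + 5) = 2" "w (j + 6) = 2"
    using W ge by linarith+
  have "a (j + 2) = 0 \<or> a (j + 4) = 0"
    using light_next_to_zero[of "j + 2"] light(3) by (simp add: eval_nat_numeral)
  moreover have "a (j + 2) \<noteq> 0"
    using light_dominated[of j] light(2) light_zero[OF light(1)] by auto
  moreover have "a (j + 4) \<noteq> 0"
    using light_dominated[of "j + 4"] light(4) light_zero[OF light(5)]
    by (auto simp: eval_nat_numeral)
  ultimately show False by blast
qed

text \<open>
  A total of \<open>7n + 1\<close> leaves room for exactly one window of weight 8; as \<open>n \<ge> 3\<close>, the two windows
  before it and the two after it are different from it and hence weigh 7.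
\<close>

lemma sum_neq: "3 * (\<Sum>i<n. w i) \<noteq> 7 * n + 1"
proof
  assume eq: "3 * (\<Sum>i<n. w i) = 7 * n + 1"
  have "(\<Sum>i<n. window i) = (\<Sum>i<n. 7 + (window i - 7))"
    using window_ge_7 by (intro sum.cong) auto
  then have "(\<Sum>i<n. window i - 7) = Suc 0"
    using eq by (simp add: sum.distrib flip: sum_window)
  then obtain k where k: "k < n" "window k - 7 = Suc 0"
    and others: "\<And>i. i < n \<Longrightarrow> i \<noteq> k \<Longrightarrow> window i - 7 = 0"
    by (subst (asm) sum_eq_Suc0_iff) auto
  have near: "window (k + d) = 7" if "0 < d" "d < n" for d
  proof -
    have "(k + d) mod n \<noteq> k mod n"
      using that by (simp add: mod_eq_dvd_iff_nat nat_dvd_not_less)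
    then have "window ((k + d) mod n) - 7 = 0"
      using k(1) n_ge_3 by (intro others) auto
    then show ?thesis
      using window_ge_7[of "k + d"] by (simp add: window_mod)
  qed
  define j where "j = k + (n - 2)"
  have j: "j + 1 = k + (n - 1)" "j + 2 = k + n" "j + 3 = k + 1 + n" "j + 4 = k + 2 + n"
    using n_ge_3 by (auto simp: j_def)
  show False
  proof (rule exceptional_window_impossible)
    show "window (j + 2) = 8"
      using k(2) by (simp only: j window_periodic)
    show "window j = 7"
      unfolding j_def using n_ge_3 by (intro near) auto
    show "window (j + 1) = 7"
      unfolding j using n_ge_3 by (intro near) auto
    show "window (j + 3) = 7" "window (j + 4) = 7"
      unfolding j window_periodic using n_ge_3 by (intro near; simp)+
  qed
qed

end

section \<open>Lower bound\<close>

context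
  fixes n :: nat and f :: "nat + nat \<Rightarrow> nat"
  assumes n: "n \<ge> 3" and f: "RDRD_function (corona_K1 (cycle_graph n)) f"
begin

lemma pair_graph_corona_cycle: "pair_graph (corona_K1 (cycle_graph n))"
  using n by (intro pair_graph_corona_K1 pair_graph_cycle_graph)

lemma leaf_cases:
  assumes "i < n"
  shows "f (Inr i) = 1 \<and> f (Inl i) \<ge> 2 \<or> f (Inr i) \<ge> 2"
proof -
  let ?G = "corona_K1 (cycle_graph n)"
  have v: "Inr i \<in> pverts ?G" "i \<in> pverts (cycle_graph n)"
    using assms by (auto simp: corona_K1_def cycle_graph_def)
  note nb = neighbours_corona_leaf[OF v(2)]
  note R = RDRD_zero_dominated[OF pair_graph_corona_cycle f]
    RDRD_one_dominated[OF pair_graph_corona_cycle f]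
    RDRD_zero_next_to_zero[OF pair_graph_corona_cycle f]
  have "f (Inr i) \<noteq> 0"
  proof
    assume 0: "f (Inr i) = 0"
    then have "f (Inl i) = 0"
      using R(3)[OF v(1)] nb by simp
    then have "card {u \<in> neighbours ?G (Inr i). f u = 2} = 0"
      "card {u \<in> neighbours ?G (Inr i). f u = 3} = 0"
      by (auto simp: nb)
    moreover have "card {u \<in> neighbours ?G (Inr i). f u = 2} \<ge> 2 \<or>
      card {u \<in> neighbours ?G (Inr i). f u = 3} \<ge> 1"
      by (rule R(1)[OF v(1) 0])
    ultimately show False by linarith
  qed
  moreover have "f (Inl i) \<ge> 2" if "f (Inr i) = 1"
    using R(2)[OF v(1) that] nb by simp
  ultimately show ?thesis by linarith
qed

lemma column_profile_of_RDRD: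
  "column_profile n (\<lambda>i. f (Inl (i mod n))) (\<lambda>i. f (Inl (i mod n)) + f (Inr (i mod n)))"
proof (rule column_profile.intro)
  let ?G = "corona_K1 (cycle_graph n)"
  let ?w = "\<lambda>i. f (Inl (i mod n)) + f (Inr (i mod n))"
  note R = RDRD_zero_dominated[OF pair_graph_corona_cycle f]
    RDRD_one_dominated[OF pair_graph_corona_cycle f]
    RDRD_zero_next_to_zero[OF pair_graph_corona_cycle f]
  have leaf: "f (Inr (i mod n)) = 1 \<and> f (Inl (i mod n)) \<ge> 2 \<or> f (Inr (i mod n)) \<ge> 2" for i
    by (rule leaf_cases) (use n in simp)
  show "n \<ge> 3" by (fact n)
  show "?w (i + n) = ?w i" for i by simp
  show "?w i \<ge> 2" for i using leaf[of i] by auto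
  have light: "f (Inl (i mod n)) = 0 \<and> f (Inr (i mod n)) = 2" if "?w i = 2" for i
    using leaf[of i] that by auto
  show "f (Inl (i mod n)) = 0" if "?w i = 2" for i
    using light[OF that] by (rule conjunct1)
  fix i assume light_next: "?w (i + 1) = 2"
  define p c q where "p = i mod n" and "c = (i + 1) mod n" and "q = (i + 2) mod n"
  have val: "f (Inl c) = 0" "f (Inr c) = 2"
    using light[OF light_next] by (simp_all only: c_def)
  have c: "c \<in> pverts (cycle_graph n)"
    using n by (simp add: c_def cycle_graph_def)
  then have v: "Inl c \<in> pverts ?G"
    by (simp add: corona_K1_def)
  have "neighbours (cycle_graph n) c = {p, q}"
    unfolding c_def p_def q_def using n by (intro neighbours_cycle_graph) simp
  then have nb: "neighbours ?G (Inl c) = {Inr c, Inl p, Inl q}"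
    by (simp add: neighbours_corona_base[OF c])
  have "\<exists>u\<in>neighbours ?G (Inl c). f u = 0"
    by (rule R(3)[OF v val(1)])
  then have "f (Inl p) = 0 \<or> f (Inl q) = 0"
    using val(2) by (simp add: nb)
  then show "f (Inl (i mod n)) = 0 \<or> f (Inl ((i + 2) mod n)) = 0"
    by (simp only: p_def q_def)
  have "f (Inl p) \<ge> 2 \<or> f (Inl q) \<ge> 2"
  proof (rule ccontr)
    assume small: "\<not> ?thesis"
    \<comment> \<open>Only the leaf would dominate, and a single neighbour of value 2 is not enough.\<close>
    let ?S = "\<lambda>c'. {u \<in> neighbours ?G (Inl c). f u = c'}"
    have S: "?S 2 = {Inr c}" "?S 3 = {}"
      using small val(2) unfolding nb by auto
    have "card (?S 2) \<ge> 2 \<or> card (?S 3) \<ge> 1"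
      by (rule R(1)[OF v val(1)])
    then show False
      unfolding S by simp
  qed
  then show "f (Inl (i mod n)) \<ge> 2 \<or> f (Inl ((i + 2) mod n)) \<ge> 2"
    by (simp only: p_def q_def)
qed

lemma RDRD_weight_ge:
  "7 * n \<le> 3 * weight (corona_K1 (cycle_graph n)) f"
  "3 * weight (corona_K1 (cycle_graph n)) f \<noteq> 7 * n + 1"
proof -
  interpret column_profile n "\<lambda>i. f (Inl (i mod n))" "\<lambda>i. f (Inl (i mod n)) + f (Inr (i mod n))"
    by (fact column_profile_of_RDRD)
  have "weight (corona_K1 (cycle_graph n)) f =
      (\<Sum>i<n. f (Inl (i mod n)) + f (Inr (i mod n)))"
    by (subst weight_corona_K1) (auto simp: cycle_graph_def lessThan_atLeast0)
  then show "7 * n \<le> 3 * weight (corona_K1 (cycle_graph n)) f"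
    "3 * weight (corona_K1 (cycle_graph n)) f \<noteq> 7 * n + 1"
    using sum_ge sum_neq by simp_all
qed

end

section \<open>Upper bound\<close>

definition heavy :: "nat \<Rightarrow> nat \<Rightarrow> bool" where
  "heavy n i \<longleftrightarrow> i mod 3 = 2 \<or> i \<ge> 3 * (n div 3)"

lemma heavy_in_block:
  assumes "k < n div 3"
  shows "\<not> heavy n (3 * k)" "\<not> heavy n (3 * k + 1)" "heavy n (3 * k + 2)"
proof -
  have lt: "3 * k + 2 < 3 * (n div 3)"
    using assms by linarith
  have residue: "3 * k mod 3 = 0" "(3 * k + 1) mod 3 = 1" "(3 * k + 2) mod 3 = 2"
    by presburger+
  show "\<not> heavy n (3 * k)" "\<not> heavy n (3 * k + 1)"
    unfolding heavy_def residue using lt by linarith+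
  show "heavy n (3 * k + 2)"
    unfolding heavy_def residue by (rule disjI1) (rule refl)
qed

definition periodic_labelling :: "nat \<Rightarrow> nat + nat \<Rightarrow> nat" where
  "periodic_labelling n = (\<lambda>v\<in>pverts (corona_K1 (cycle_graph n)).
     case v of Inl i \<Rightarrow> if heavy n i then 2 else 0 | Inr i \<Rightarrow> if heavy n i then 1 else 2)"

lemma periodic_labelling_simps:
  assumes "i < n"
  shows "periodic_labelling n (Inl i) = (if heavy n i then 2 else 0)"
    and "periodic_labelling n (Inr i) = (if heavy n i then 1 else 2)"
  using assms by (auto simp: periodic_labelling_def corona_K1_def cycle_graph_def)

text \<open>
  Around the cycle the light columns come in pairs, with a heavy column on either side; the first
  pair is preceded by column \<open>n - 1\<close>, which is heavy for every residue of \<open>n\<close>.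
\<close>

lemma light_column_neighbours:
  assumes "n \<ge> 3" "i < n" "\<not> heavy n i"
  obtains p q where "p < n" "q < n" "neighbours (cycle_graph n) i = {p, q}"
    "heavy n p" "\<not> heavy n q"
proof -
  define m where "m = n div 3"
  have m: "3 * m \<le> n" "n < 3 * m + 3"
    unfolding m_def by linarith+
  have i: "i < 3 * m" "i mod 3 = 0 \<or> i mod 3 = 1"
    using assms(3) by (auto simp: heavy_def m_def)
  obtain k where k: "i = 3 * k \<or> i = 3 * k + 1" "k < m"
  proof
    show "i = 3 * (i div 3) \<or> i = 3 * (i div 3) + 1"
      using i(2) div_mult_mod_eq[of i 3] by linarith
    show "i div 3 < m" using i(1) by linarith
  qed
  note block = heavy_in_block[of _ n, folded m_def]
  show ?thesis
  proof (cases "i = 3 * k")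
    case True
    show ?thesis
    proof (cases "k = 0")
      case True
      have "neighbours (cycle_graph n) ((n - 1 + 1) mod n) = {(n - 1) mod n, (n - 1 + 2) mod n}"
        using assms(1) by (intro neighbours_cycle_graph) simp
      moreover have "(n - 1 + 2) mod n = 1"
        using assms(1) by (simp add: mod_if)
      ultimately have nb: "neighbours (cycle_graph n) i = {n - 1, 1}"
        using assms(1) True \<open>i = 3 * k\<close> by simp
      have "heavy n (n - 1)"
      proof (cases "n = 3 * m")
        case True
        then have "n - 1 = 3 * (m - 1) + 2" "m - 1 < m"
          using assms(1) by linarith+
        then show ?thesis
          using block(3)[of "m - 1"] by simp
      next
        case False
        then show ?thesis
          using m unfolding heavy_def m_def[symmetric] by linarith
      qed
      moreover have "\<not> heavy n 1"
        using block(2)[of 0] k(2) by simp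
      ultimately show ?thesis
        using assms(1) by (intro that[OF _ _ nb]) auto
    next
      case False
      have "neighbours (cycle_graph n) ((i - 1 + 1) mod n) = {(i - 1) mod n, (i - 1 + 2) mod n}"
        using assms(1) by (intro neighbours_cycle_graph) simp
      moreover have "i + 1 < n"
        using True k(2) m by linarith
      ultimately have nb: "neighbours (cycle_graph n) i = {i - 1, i + 1}"
        using assms(2) True False by simp
      have "i - 1 = 3 * (k - 1) + 2" "k - 1 < m"
        using True False k(2) by linarith+
      then have "heavy n (i - 1)" "\<not> heavy n (i + 1)"
        using block(3)[of "k - 1"] block(2)[OF k(2)] True by simp_all
      then show ?thesis
        using assms(2) \<open>i + 1 < n\<close> by (intro that[OF _ _ nb]) auto
    qed
  next
    case False
    then have i_eq: "i = 3 * k + 1" using k(1) by simp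
    have "neighbours (cycle_graph n) ((3 * k + 1) mod n) = {3 * k mod n, (3 * k + 2) mod n}"
      using assms(1) by (intro neighbours_cycle_graph) simp
    moreover have "3 * k + 2 < n"
      using k(2) m by linarith
    ultimately have nb: "neighbours (cycle_graph n) i = {3 * k + 2, 3 * k}"
      using i_eq by auto
    have "heavy n (3 * k + 2)" "\<not> heavy n (3 * k)"
      using block[OF k(2)] by simp_all
    then show ?thesis
      using \<open>3 * k + 2 < n\<close> by (intro that[OF _ _ nb]) auto
  qed
qed

lemma RDRD_periodic_labelling:
  assumes "n \<ge> 3"
  shows "RDRD_function (corona_K1 (cycle_graph n)) (periodic_labelling n)"
proof -
  let ?G = "corona_K1 (cycle_graph n)"
  let ?f = "periodic_labelling n"
  have pg: "pair_graph ?G"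
    using assms by (intro pair_graph_corona_K1 pair_graph_cycle_graph)
  have verts: "v \<in> pverts ?G \<longleftrightarrow> (\<exists>i<n. v = Inl i \<or> v = Inr i)" for v
    by (auto simp: corona_K1_def cycle_graph_def)
  have range: "?f \<in> pverts ?G \<rightarrow>\<^sub>E {0, 1, 2, 3}"
    by (auto simp: periodic_labelling_def split: sum.splits)
  have zero: "card {u \<in> neighbours ?G v. ?f u = 2} \<ge> 2 \<and> (\<exists>u\<in>neighbours ?G v. ?f u = 0)"
    if v: "v \<in> pverts ?G" and 0: "?f v = 0" for v
  proof -
    from v 0 obtain i where i: "i < n" "v = Inl i" "\<not> heavy n i"
      by (auto simp: verts periodic_labelling_simps split: if_splits)
    obtain p q where pq: "p < n" "q < n" "neighbours (cycle_graph n) i = {p, q}"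
      "heavy n p" "\<not> heavy n q"
      using light_column_neighbours[OF assms i(1,3)] .
    have nb: "neighbours ?G v = {Inr i, Inl p, Inl q}"
      unfolding i(2) using i(1) pq(3)
      by (subst neighbours_corona_base) (auto simp: cycle_graph_def)
    have "{u \<in> neighbours ?G v. ?f u = 2} = {Inr i, Inl p}"
      unfolding nb using i pq by (auto simp: periodic_labelling_simps)
    moreover have "?f (Inl q) = 0"
      using pq by (simp add: periodic_labelling_simps)
    ultimately show ?thesis
      by (simp add: nb)
  qed
  have one: "\<exists>u\<in>neighbours ?G v. ?f u \<ge> 2" if v: "v \<in> pverts ?G" and 1: "?f v = 1" for v
  proof -
    from v 1 obtain i where i: "i < n" "v = Inr i" "heavy n i"
      by (auto simp: verts periodic_labelling_simps split: if_splits)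
    have "neighbours ?G v = {Inl i}"
      unfolding i(2) using i(1) by (intro neighbours_corona_leaf) (simp add: cycle_graph_def)
    then show ?thesis
      using i by (simp add: periodic_labelling_simps)
  qed
  show ?thesis
    unfolding RDRD_function_iff[OF pg] using range zero one by blast
qed

lemma weight_periodic_labelling:
  "weight (corona_K1 (cycle_graph n)) (periodic_labelling n) = 7 * (n div 3) + 3 * (n mod 3)"
proof -
  define m where "m = n div 3"
  let ?c = "\<lambda>i. if heavy n i then 3 else 2 :: nat"
  note block = heavy_in_block[of _ n, folded m_def]
  have tail: "heavy n (3 * m + r)" for r
    unfolding heavy_def m_def by (intro disjI2 le_add1)
  have n_eq: "3 * m + n mod 3 = n"
    unfolding m_def by (rule mult_div_mod_eq)
  have blocks: "(\<Sum>i<3 * k. ?c i) = 7 * k" if "k \<le> m" for k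
    using that
  proof (induction k)
    case (Suc k)
    have step: "3 * Suc k = Suc (Suc (Suc (3 * k)))" by simp
    have "k < m" using Suc.prems by simp
    from block[OF this]
    have "\<not> heavy n (3 * k)" "\<not> heavy n (Suc (3 * k))" "heavy n (Suc (Suc (3 * k)))"
      by simp_all
    moreover have "(\<Sum>i<3 * k. ?c i) = 7 * k"
      using Suc by simp
    ultimately show ?case
      unfolding step by simp
  qed simp
  have rest: "(\<Sum>i<3 * m + r. ?c i) = (\<Sum>i<3 * m. ?c i) + 3 * r" for r
    by (induction r) (simp_all add: tail)
  have "weight (corona_K1 (cycle_graph n)) (periodic_labelling n) = (\<Sum>i<n. ?c i)"
  proof -
    have "pverts (cycle_graph n) = {..<n}"
      by (auto simp: cycle_graph_def)
    then have "weight (corona_K1 (cycle_graph n)) (periodic_labelling n) =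
        (\<Sum>i<n. periodic_labelling n (Inl i) + periodic_labelling n (Inr i))"
      by (simp add: weight_corona_K1)
    also have "\<dots> = (\<Sum>i<n. ?c i)"
      by (rule sum.cong[OF refl]) (simp add: periodic_labelling_simps)
    finally show ?thesis .
  qed
  also have "\<dots> = 7 * m + 3 * (n mod 3)"
    using rest[of "n mod 3"] blocks[OF order.refl] by (simp only: n_eq)
  finally show ?thesis
    unfolding m_def .
qed

section \<open>The restrained double Roman domination number\<close>

theorem theorem5p6:
  fixes n :: nat
  assumes "n \<ge> 3"
  shows "int (\<gamma>\<^sub>r\<^sub>d\<^sub>R (corona_K1 (cycle_graph n))) =
    (if n mod 3 = 0 \<or> n mod 3 = 1 then \<lceil>7 * real n / 3\<rceil>
     else \<lceil>7 * real n / 3\<rceil> + 1)"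
proof -
  let ?g = "\<gamma>\<^sub>r\<^sub>d\<^sub>R (corona_K1 (cycle_graph n))"
  obtain f where f: "RDRD_function (corona_K1 (cycle_graph n)) f"
    "weight (corona_K1 (cycle_graph n)) f = ?g"
    using rdR_number_attained by blast
  have lower: "7 * n \<le> 3 * ?g" "3 * ?g \<noteq> 7 * n + 1"
    using RDRD_weight_ge[OF assms f(1)] f(2) by auto
  have upper: "?g \<le> 7 * (n div 3) + 3 * (n mod 3)"
    using rdR_number_le[OF RDRD_periodic_labelling[OF assms]] by (simp add: weight_periodic_labelling)
  define g m where "g = ?g" and "m = n div 3"
  have bounds: "7 * n \<le> 3 * g" "3 * g \<noteq> 7 * n + 1" "g \<le> 7 * m + 3 * (n mod 3)"
    using lower upper unfolding g_def m_def .
  have n_eq: "n = 3 * m + n mod 3"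
    unfolding m_def by (rule mult_div_mod_eq[symmetric])
  consider "n mod 3 = 0" | "n mod 3 = 1" | "n mod 3 = 2"
    by linarith
  then have "int g = (if n mod 3 = 0 \<or> n mod 3 = 1 then \<lceil>7 * real n / 3\<rceil>
     else \<lceil>7 * real n / 3\<rceil> + 1)"
  proof cases
    case 1
    then have n: "n = 3 * m" using n_eq by linarith
    then have "g = 7 * m" using bounds 1 by linarith
    moreover have "\<lceil>7 * real n / 3\<rceil> = 7 * int m"
      unfolding n by (intro ceiling_unique) simp_all
    ultimately show ?thesis using 1 by simp
  next
    case 2
    then have n: "n = 3 * m + 1" using n_eq by linarith
    then have "g = 7 * m + 3" using bounds 2 by linarith
    moreover have "\<lceil>7 * real n / 3\<rceil> = 7 * int m + 3"
      unfolding n by (intro ceiling_unique) simp_all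
    ultimately show ?thesis using 2 by simp
  next
    case 3
    then have n: "n = 3 * m + 2" using n_eq by linarith
    have "g \<noteq> 7 * m + 5" "7 * m + 4 < g" "g \<le> 7 * m + 6"
      using bounds 3 n by linarith+
    then have "g = 7 * m + 6" by linarith
    moreover have "\<lceil>7 * real n / 3\<rceil> = 7 * int m + 5"
      unfolding n by (intro ceiling_unique) simp_all
    ultimately show ?thesis using 3 by simp
  qed
  then show ?thesis
    unfolding g_def .
qed

end
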